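(* Let $\Lambda\subseteq[0,\infty)$ be an additive semigroup with $0\in\Lambda$, and let $w$ be an admissible weight function on $\Lambda$. Then the group of invertible elements of the Banach algebra $\mathscr{A}_w(\Lambda)$ is $$\mathscr{A}_w^*(\Lambda)=\{a\in\mathscr{A}_w(\Lambda):\ 0\notin\overline{\widetilde a(\mathbb{H})}\}.$$
   Context: $\mathbb{H}=\{s\in\mathbb{C}:\operatorname{Re}s>0\}$. A weight function on $\Lambda$ is a map $w\colon\Lambda\to(0,\infty)$ with $w(0)=1$ and $w(\lambda'+\lambda'')\le w(\lambda')w(\lambda'')$ for all $\lambda',\lambda''\in\Lambda$. It is admissible if (a) $w(\lambda)\ge1$ for all $\lambda\in\Lambda$ and (b) $\lim_{k\to\infty}w(k\lambda)^{1/k}=1$ for all $\lambda\in\Lambda$, where $k\lambda$ denotes the $k$-fold sum. $\mathscr{A}_w(\Lambda)$ is the set of $a\colon\Lambda\to\mathbb{C}$ with $\|a\|_w:=\sum_{\lambda\in\Lambda}|a(\lambda)|w(\lambda)<\infty$, with pointwise linear operations and convolution $(a*b)(\lambda)=\sum_{\lambda'+\lambda''=\lambda}a(\lambda')b(\lambda'')$; it is a commutative unital Banach algebra with unit $\varepsilon=\delta_0$ (where $\delta_\mu(\lambda)=1$ if $\lambda=\mu$ and $0$ otherwise). For $a\in\mathscr{A}_w(\Lambda)$, $\widetilde a(s)=\sum_{\lambda\in\Lambda}a(\lambda)e^{-\lambda s}$ for $s\in\overline{\mathbb{H}}$. *)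

theory Defs
  imports "HOL-Analysis.Analysis"
begin

text \<open>Elements of the semigroup \<Lambda> are reals; sequences a on \<Lambda> are represented as
  functions real \<Rightarrow> complex vanishing outside \<Lambda>.\<close>

definition weight_function :: "real set \<Rightarrow> (real \<Rightarrow> real) \<Rightarrow> bool" where
  "weight_function \<Lambda> w \<longleftrightarrow>
     (\<forall>x\<in>\<Lambda>. w x > 0) \<and> w 0 = 1 \<and>
     (\<forall>x\<in>\<Lambda>. \<forall>y\<in>\<Lambda>. w (x + y) \<le> w x * w y)"

definition admissible_weight :: "real set \<Rightarrow> (real \<Rightarrow> real) \<Rightarrow> bool" where
  "admissible_weight \<Lambda> w \<longleftrightarrow> weight_function \<Lambda> w \<and>
     (\<forall>x\<in>\<Lambda>. w x \<ge> 1) \<and>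
     (\<forall>x\<in>\<Lambda>. (\<lambda>k::nat. root k (w (real k * x))) \<longlonglongrightarrow> 1)"

definition Aw :: "real set \<Rightarrow> (real \<Rightarrow> real) \<Rightarrow> (real \<Rightarrow> complex) set" where
  "Aw \<Lambda> w = {a. (\<forall>x. x \<notin> \<Lambda> \<longrightarrow> a x = 0) \<and>
                 (\<lambda>x. norm (a x) * w x) summable_on \<Lambda>}"

definition conv :: "real set \<Rightarrow> (real \<Rightarrow> complex) \<Rightarrow> (real \<Rightarrow> complex) \<Rightarrow> real \<Rightarrow> complex" where
  "conv \<Lambda> a b = (\<lambda>x. if x \<in> \<Lambda> then
      (\<Sum>\<^sub>\<infinity>(p, q) \<in> {(p, q). p \<in> \<Lambda> \<and> q \<in> \<Lambda> \<and> p + q = x}. a p * b q) else 0)"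

definition unit_elem :: "real \<Rightarrow> complex" where
  "unit_elem = (\<lambda>x. if x = 0 then 1 else 0)"

definition invertible_Aw :: "real set \<Rightarrow> (real \<Rightarrow> real) \<Rightarrow> (real \<Rightarrow> complex) \<Rightarrow> bool" where
  "invertible_Aw \<Lambda> w a \<longleftrightarrow> a \<in> Aw \<Lambda> w \<and> (\<exists>b \<in> Aw \<Lambda> w. conv \<Lambda> a b = unit_elem)"

definition dirichlet_transform :: "real set \<Rightarrow> (real \<Rightarrow> complex) \<Rightarrow> complex \<Rightarrow> complex" where
  "dirichlet_transform \<Lambda> a s = (\<Sum>\<^sub>\<infinity>x\<in>\<Lambda>. a x * exp (- (complex_of_real x) * s))"

definition right_half_plane :: "complex set" where
  "right_half_plane = {s. Re s > 0}"

end

theory Submission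
  imports Defs "HOL-Complex_Analysis.Cauchy_Integral_Theorem"
begin

text \<open>
  If the transform of \<open>a\<close> is bounded below by \<open>\<delta>\<close> on the half-plane, write \<open>a = f - h\<close> with \<open>f\<close>
  of finite support and \<open>h\<close> of norm at most \<open>\<delta> / 4\<close>, and invert by Newman's series
  \<open>1 / (f - h) = \<Sum>n. h ^ n / f ^ (n + 1)\<close>. This needs \<open>1 / f ^ n\<close> to have norm \<open>O((2 / \<delta>) ^ n)\<close>. A
  Dirichlet polynomial has a bounded derivative on vertical strips, so \<open>1 / f ^ n\<close> is bounded by
  \<open>(2 / \<delta>) ^ n\<close> on a slightly larger half-plane \<open>Re s > - \<kappa>\<close>; moving the line of integration in the
  mean value formula for its Dirichlet coefficients makes them
  \<open>O((2 / \<delta>) ^ n exp (- \<kappa> x / 2))\<close>. They are supported in a finitely generated semigroup \<open>T\<close>, on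
  which admissibility of the weight makes \<open>exp (- \<kappa> x / 2) w x\<close> summable.
\<close>

section \<open>Weighted convolution algebras and their transforms\<close>

lemma summable_on_fibre:
  fixes f :: "'i \<Rightarrow> 'b::banach"
  assumes "f summable_on I"
  shows "f summable_on {i \<in> I. h i = x}"
  using assms by (rule summable_on_subset_banach) auto

text \<open>Reindexing \<open>i\<close> as \<open>(h i, i)\<close> presents \<open>I\<close> as the
  disjoint union of the fibres of \<open>h\<close>, so the total can be computed as an iterated sum.
  Each inner sum exists because summability in a Banach space passes to subsets.\<close>

lemma has_sum_fibres:
  fixes f :: "'i \<Rightarrow> 'b::banach"
  assumes f: "(f has_sum s) I" and h: "h ` I \<subseteq> S"
  shows "((\<lambda>x. infsum f {i \<in> I. h i = x}) has_sum s) S"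
proof -
  have "bij_betw (\<lambda>i. (h i, i)) I (Sigma S (\<lambda>x. {i \<in> I. h i = x}))"
    using h by (intro bij_betwI[where g = snd]) auto
  then have "((\<lambda>z. f (snd z)) has_sum s) (Sigma S (\<lambda>x. {i \<in> I. h i = x}))"
    by (subst has_sum_reindex_bij_betw[symmetric]) (use f in auto)
  then show ?thesis
  proof (rule has_sum_Sigma[OF isUCont_plus])
    fix x
    have "f summable_on {i \<in> I. h i = x}"
      by (rule summable_on_fibre[OF has_sum_imp_summable[OF f]])
    then show "((\<lambda>i. f (snd (x, i))) has_sum infsum f {i \<in> I. h i = x}) {i \<in> I. h i = x}"
      by simp
  qed
qed

definition weighted_norm :: "real set \<Rightarrow> (real \<Rightarrow> real) \<Rightarrow> (real \<Rightarrow> complex) \<Rightarrow> real" where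
  "weighted_norm S v a = (\<Sum>\<^sub>\<infinity>x\<in>S. norm (a x) * v x)"

text \<open>The bound \<open>exp_le_weight\<close> makes transforms converge absolutely for
  \<open>Re s \<ge> c\<close>. The parameter \<open>c\<close> is there because two algebras are
  used: the given one with \<open>c = 0\<close>, and an auxiliary one with decaying weight
  \<open>exp (- \<sigma> * x)\<close> and \<open>c = \<sigma>\<close>.\<close>

locale weighted_semigroup =
  fixes S :: "real set" and v :: "real \<Rightarrow> real" and c :: real
  assumes nonneg: "x \<in> S \<Longrightarrow> 0 \<le> x"
    and zero_mem: "0 \<in> S"
    and add_mem: "x \<in> S \<Longrightarrow> y \<in> S \<Longrightarrow> x + y \<in> S"
    and weight_zero: "v 0 = 1"
    and weight_add: "x \<in> S \<Longrightarrow> y \<in> S \<Longrightarrow> v (x + y) \<le> v x * v y"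
    and exp_le_weight: "x \<in> S \<Longrightarrow> exp (- c * x) \<le> v x"
begin

lemma weight_pos: "x \<in> S \<Longrightarrow> 0 < v x"
  using exp_le_weight[of x] exp_gt_zero[of "- c * x"] by linarith

lemma norm_exp_le_weight:
  assumes "x \<in> S" "c \<le> Re s"
  shows "norm (exp (- complex_of_real x * s)) \<le> v x"
proof -
  have "x * c \<le> x * Re s"
    using nonneg assms by (intro mult_left_mono) auto
  then have "norm (exp (- complex_of_real x * s)) \<le> exp (- c * x)"
    by (simp add: mult.commute)
  also have "\<dots> \<le> v x"
    using assms exp_le_weight by blast
  finally show ?thesis .
qed

text \<open>Specialises both to convolutions (\<open>h\<close> addition) and to countable sums (\<open>h\<close> a projection).\<close>

lemma push_forward:
  fixes g :: "'i \<Rightarrow> complex" and h :: "'i \<Rightarrow> real"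
  assumes h: "h ` I \<subseteq> S" and g: "((\<lambda>i. norm (g i) * v (h i)) has_sum N) I"
  defines "b \<equiv> \<lambda>x. if x \<in> S then \<Sum>\<^sub>\<infinity>i\<in>{i \<in> I. h i = x}. g i else 0"
  shows "b \<in> Aw S v" and "weighted_norm S v b \<le> N"
    and "c \<le> Re s \<Longrightarrow> dirichlet_transform S b s = (\<Sum>\<^sub>\<infinity>i\<in>I. g i * exp (- complex_of_real (h i) * s))"
proof -
  have fib: "((\<lambda>x. \<Sum>\<^sub>\<infinity>i\<in>{i \<in> I. h i = x}. norm (g i) * v (h i)) has_sum N) S"
    using has_sum_fibres[OF g h] .
  have le: "norm (b x) * v x \<le> (\<Sum>\<^sub>\<infinity>i\<in>{i \<in> I. h i = x}. norm (g i) * v (h i))" if x: "x \<in> S" for x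
  proof -
    \<comment> \<open>The weight has the constant value \<open>v x\<close> on the fibre. Being
      positive, it can be cancelled, which gives summability of \<open>norm (g i)\<close> there and
      so the triangle inequality for \<open>b x\<close>.\<close>
    have eq: "(\<Sum>\<^sub>\<infinity>i\<in>{i \<in> I. h i = x}. norm (g i) * v (h i)) = (\<Sum>\<^sub>\<infinity>i\<in>{i \<in> I. h i = x}. norm (g i)) * v x"
      by (subst infsum_cmult_left'[symmetric]) (auto intro!: infsum_cong)
    have "(\<lambda>i. norm (g i) * v (h i)) summable_on {i \<in> I. h i = x}"
      using summable_on_fibre[OF has_sum_imp_summable[OF g]] .
    then have "(\<lambda>i. norm (g i) * v x) summable_on {i \<in> I. h i = x}"
      by (rule summable_on_cong[THEN iffD1, rotated]) auto
    then have "(\<lambda>i. norm (g i)) summable_on {i \<in> I. h i = x}"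
      using weight_pos[OF x] by (simp add: summable_on_cmult_left')
    then have "norm (b x) \<le> (\<Sum>\<^sub>\<infinity>i\<in>{i \<in> I. h i = x}. norm (g i))"
      using x by (simp add: b_def norm_infsum_bound)
    then show ?thesis
      unfolding eq using weight_pos[OF x] by (simp add: mult_right_mono)
  qed
  have sm: "(\<lambda>x. norm (b x) * v x) summable_on S"
    by (rule summable_on_comparison_test[OF has_sum_imp_summable[OF fib] le])
       (simp_all add: weight_pos less_imp_le)
  then show "b \<in> Aw S v"
    by (auto simp: Aw_def b_def)
  show "weighted_norm S v b \<le> N"
    unfolding weighted_norm_def
    by (rule has_sum_mono[OF has_sum_infsum[OF sm] fib le])
  assume s: "c \<le> Re s"
  let ?f = "\<lambda>i. g i * exp (- complex_of_real (h i) * s)"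
  have "(\<lambda>i. norm (?f i)) summable_on I"
  proof (rule Infinite_Sum.abs_summable_on_comparison_test'[OF has_sum_imp_summable[OF g]])
    fix i assume "i \<in> I"
    then show "norm (?f i) \<le> norm (g i) * v (h i)"
      unfolding norm_mult using h s by (intro mult_left_mono norm_exp_le_weight) auto
  qed
  then have "(?f has_sum infsum ?f I) I"
    by (rule has_sum_infsum[OF abs_summable_summable])
  from has_sum_fibres[OF this h]
  have "infsum ?f I = (\<Sum>\<^sub>\<infinity>x\<in>S. infsum ?f {i \<in> I. h i = x})"
    by (simp add: infsumI)
  also have "\<dots> = dirichlet_transform S b s"
    unfolding dirichlet_transform_def
  proof (rule infsum_cong)
    fix x assume x: "x \<in> S"
    have "infsum ?f {i \<in> I. h i = x} = (\<Sum>\<^sub>\<infinity>i\<in>{i \<in> I. h i = x}. g i * exp (- complex_of_real x * s))"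
      by (rule infsum_cong) auto
    also have "\<dots> = b x * exp (- complex_of_real x * s)"
      using x by (simp add: b_def infsum_cmult_left')
    finally show "infsum ?f {i \<in> I. h i = x} = b x * exp (- complex_of_real x * s)" .
  qed
  finally show "dirichlet_transform S b s = infsum ?f I" ..
qed

lemma Aw_has_sum: "a \<in> Aw S v \<Longrightarrow> ((\<lambda>x. norm (a x) * v x) has_sum weighted_norm S v a) S"
  by (simp add: Aw_def weighted_norm_def)

lemma weighted_norm_nonneg: "0 \<le> weighted_norm S v a"
  unfolding weighted_norm_def by (rule infsum_nonneg) (simp add: weight_pos less_imp_le)

lemma transform_abs_summable:
  assumes "a \<in> Aw S v" "c \<le> Re s"
  shows "(\<lambda>x. norm (a x * exp (- complex_of_real x * s))) summable_on S"
  by (rule Infinite_Sum.abs_summable_on_comparison_test'[OF has_sum_imp_summable[OF Aw_has_sum[OF assms(1)]]])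
     (unfold norm_mult, intro mult_left_mono norm_exp_le_weight, use assms in auto)

lemma transform_has_sum:
  assumes "a \<in> Aw S v" "c \<le> Re s"
  shows "((\<lambda>x. a x * exp (- complex_of_real x * s)) has_sum dirichlet_transform S a s) S"
  unfolding dirichlet_transform_def
  by (rule has_sum_infsum[OF abs_summable_summable[OF transform_abs_summable[OF assms]]])

lemma norm_transform_le:
  assumes "a \<in> Aw S v" "c \<le> Re s"
  shows "norm (dirichlet_transform S a s) \<le> weighted_norm S v a"
  by (rule norm_infsum_le[OF transform_has_sum[OF assms] Aw_has_sum[OF assms(1)]])
     (unfold norm_mult, intro mult_left_mono norm_exp_le_weight, use assms in auto)

text \<open>All three claims are \<open>push_forward\<close> for addition on
  \<open>S \<times> S\<close>. Submultiplicativity of \<open>v\<close> dominates the double series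
  by the product of the two norm series, and this domination also justifies factoring the transform
  by Fubini.\<close>

lemma
  assumes a: "a \<in> Aw S v" and b: "b \<in> Aw S v"
  shows conv_in_Aw: "conv S a b \<in> Aw S v"
    and weighted_norm_conv_le: "weighted_norm S v (conv S a b) \<le> weighted_norm S v a * weighted_norm S v b"
    and transform_conv: "c \<le> Re s \<Longrightarrow>
      dirichlet_transform S (conv S a b) s = dirichlet_transform S a s * dirichlet_transform S b s"
proof -
  let ?g = "\<lambda>(p, q). a p * b q" and ?h = "\<lambda>(p, q). p + q :: real"
  have hS: "?h ` (S \<times> S) \<subseteq> S"
    using add_mem by auto
  have conv_eq: "conv S a b = (\<lambda>x. if x \<in> S then \<Sum>\<^sub>\<infinity>i\<in>{i \<in> S \<times> S. ?h i = x}. ?g i else 0)"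
  proof -
    have "{(p, q). p \<in> S \<and> q \<in> S \<and> p + q = x} = {i \<in> S \<times> S. ?h i = x}" for x
      by auto
    then show ?thesis
      unfolding conv_def by metis
  qed
  let ?na = "\<lambda>x. norm (a x) * v x" and ?nb = "\<lambda>x. norm (b x) * v x"
  have prod: "((\<lambda>(p, q). ?na p * ?nb q) has_sum (weighted_norm S v a * weighted_norm S v b)) (S \<times> S)"
  proof (rule has_sum_SigmaI)
    show "((\<lambda>q. case (p, q) of (p, q) \<Rightarrow> ?na p * ?nb q) has_sum (?na p * weighted_norm S v b)) S" for p
      using has_sum_cmult_right[OF Aw_has_sum[OF b]] by simp
    show "((\<lambda>p. ?na p * weighted_norm S v b) has_sum (weighted_norm S v a * weighted_norm S v b)) S"
      using has_sum_cmult_left[OF Aw_has_sum[OF a]] by simp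
    then show "(\<lambda>(p, q). ?na p * ?nb q) summable_on S \<times> S"
      using has_sum_cmult_right[OF Aw_has_sum[OF b]]
      by (intro summable_on_SigmaI[where g = "\<lambda>p. ?na p * weighted_norm S v b"])
         (auto intro: has_sum_imp_summable simp: weight_pos less_imp_le)
  qed
  have le: "norm (?g i) * v (?h i) \<le> (case i of (p, q) \<Rightarrow> ?na p * ?nb q)" if "i \<in> S \<times> S" for i
  proof -
    obtain p q where i: "i = (p, q)" "p \<in> S" "q \<in> S"
      using \<open>i \<in> S \<times> S\<close> by auto
    have "norm (a p * b q) * v (p + q) \<le> norm (a p * b q) * (v p * v q)"
      using i weight_add by (intro mult_left_mono) auto
    then show ?thesis
      by (simp add: i norm_mult mult_ac)
  qed
  have sm: "(\<lambda>i. norm (?g i) * v (?h i)) summable_on S \<times> S"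
  proof (rule summable_on_comparison_test[OF has_sum_imp_summable[OF prod] le])
    fix i assume "i \<in> S \<times> S"
    then show "0 \<le> norm (?g i) * v (?h i)"
      using hS weight_pos[of "?h i"] by (intro mult_nonneg_nonneg) auto
  qed
  note hs = has_sum_infsum[OF sm]
  show "conv S a b \<in> Aw S v"
    unfolding conv_eq by (rule push_forward(1)[OF hS hs])
  have "weighted_norm S v (conv S a b) \<le> (\<Sum>\<^sub>\<infinity>i\<in>S \<times> S. norm (?g i) * v (?h i))"
    unfolding conv_eq by (rule push_forward(2)[OF hS hs])
  also have "\<dots> \<le> weighted_norm S v a * weighted_norm S v b"
    by (rule has_sum_mono[OF hs prod le])
  finally show "weighted_norm S v (conv S a b) \<le> weighted_norm S v a * weighted_norm S v b" .
  assume s: "c \<le> Re s"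
  let ?A = "\<lambda>x. a x * exp (- complex_of_real x * s)" and ?B = "\<lambda>x. b x * exp (- complex_of_real x * s)"
  have "dirichlet_transform S (conv S a b) s = (\<Sum>\<^sub>\<infinity>i\<in>S \<times> S. ?g i * exp (- complex_of_real (?h i) * s))"
    unfolding conv_eq by (rule push_forward(3)[OF hS hs s])
  also have "\<dots> = (\<Sum>\<^sub>\<infinity>(p, q)\<in>S \<times> S. ?A p * ?B q)"
  proof (rule infsum_cong, safe)
    fix p q
    have "exp (- complex_of_real (p + q) * s) = exp (- complex_of_real p * s) * exp (- complex_of_real q * s)"
      by (simp add: algebra_simps flip: exp_add)
    then show "a p * b q * exp (- complex_of_real (p + q) * s) = ?A p * ?B q"
      by simp
  qed
  also have "\<dots> = dirichlet_transform S a s * dirichlet_transform S b s"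
  proof (rule infsumI, rule has_sum_SigmaI)
    show "((\<lambda>q. case (p, q) of (p, q) \<Rightarrow> ?A p * ?B q) has_sum (?A p * dirichlet_transform S b s)) S" for p
      using has_sum_cmult_right[OF transform_has_sum[OF b s]] by simp
    show "((\<lambda>p. ?A p * dirichlet_transform S b s) has_sum (dirichlet_transform S a s * dirichlet_transform S b s)) S"
      using has_sum_cmult_left[OF transform_has_sum[OF a s]] by simp
    have "(\<lambda>i. norm (case i of (p, q) \<Rightarrow> ?A p * ?B q)) summable_on S \<times> S"
    proof (rule Infinite_Sum.abs_summable_on_comparison_test'[OF has_sum_imp_summable[OF prod]])
      fix i assume "i \<in> S \<times> S"
      then obtain p q where i: "i = (p, q)" "p \<in> S" "q \<in> S"
        by auto
      have "norm (?A p) * norm (?B q) \<le> ?na p * ?nb q"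
        unfolding norm_mult using i s weight_pos
        by (intro mult_mono mult_left_mono norm_exp_le_weight mult_nonneg_nonneg) (auto intro: less_imp_le)
      then show "norm (case i of (p, q) \<Rightarrow> ?A p * ?B q) \<le> (case i of (p, q) \<Rightarrow> ?na p * ?nb q)"
        by (simp add: i norm_mult)
    qed
    then show "(\<lambda>(p, q). ?A p * ?B q) summable_on S \<times> S"
      by (rule abs_summable_summable)
  qed
  finally show "dirichlet_transform S (conv S a b) s = dirichlet_transform S a s * dirichlet_transform S b s" .
qed

text \<open>
  Since transforms turn convolutions into products, the algebra is handled through the functions
  which are transforms of elements of norm at most \<open>N\<close>.
\<close>

definition represents :: "real \<Rightarrow> (complex \<Rightarrow> complex) \<Rightarrow> bool" where
  "represents N F \<longleftrightarrow> (\<exists>b \<in> Aw S v. weighted_norm S v b \<le> N \<and>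
     (\<forall>s. c < Re s \<longrightarrow> F s = dirichlet_transform S b s))"

lemma represents_mult:
  assumes "represents M F" "represents N G"
  shows "represents (M * N) (\<lambda>s. F s * G s)"
proof -
  obtain a b where a: "a \<in> Aw S v" "weighted_norm S v a \<le> M"
    "\<And>s. c < Re s \<Longrightarrow> F s = dirichlet_transform S a s"
    and b: "b \<in> Aw S v" "weighted_norm S v b \<le> N"
    "\<And>s. c < Re s \<Longrightarrow> G s = dirichlet_transform S b s"
    using assms unfolding represents_def by metis
  have "weighted_norm S v (conv S a b) \<le> weighted_norm S v a * weighted_norm S v b"
    by (rule weighted_norm_conv_le[OF a(1) b(1)])
  also have "\<dots> \<le> M * N"
    using a(2) b(2) weighted_norm_nonneg[of a] weighted_norm_nonneg[of b] by (intro mult_mono) linarith+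
  finally show ?thesis
    unfolding represents_def
    using conv_in_Aw[OF a(1) b(1)] transform_conv[OF a(1) b(1)] a(3) b(3)
    by (intro bexI[of _ "conv S a b"]) auto
qed

lemma represents_finite_sum:
  assumes F: "finite F" "F \<subseteq> S"
  shows "represents (\<Sum>x\<in>F. norm (a x) * v x) (\<lambda>s. \<Sum>x\<in>F. a x * exp (- complex_of_real x * s))"
proof -
  have id: "(\<lambda>x. x) ` F \<subseteq> S" and hs: "((\<lambda>x. norm (a x) * v x) has_sum (\<Sum>x\<in>F. norm (a x) * v x)) F"
    using F by auto
  show ?thesis
    unfolding represents_def
    using push_forward[OF id hs] F by (intro bexI conjI allI impI) auto
qed

lemma represents_const: "represents (norm z) (\<lambda>s. z)"
  using represents_finite_sum[of "{0}" "\<lambda>x. z"] by (simp add: zero_mem weight_zero)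

lemma represents_power: "represents N F \<Longrightarrow> represents (N ^ n) (\<lambda>s. F s ^ n)"
  by (induction n) (use represents_const[of 1] represents_mult in auto)

text \<open>This is completeness of the algebra: the coefficients \<open>b n x\<close> form one
  absolutely summable family on pairs \<open>(n, x)\<close>. Pushing it forward along
  \<open>snd\<close> adds the elements coefficientwise, while summing over \<open>x\<close> first
  gives the series of transforms.\<close>

lemma represents_suminf:
  assumes F: "\<And>n. represents (N n) (F n)" and N: "summable N"
  shows "represents (suminf N) (\<lambda>s. \<Sum>n. F n s)"
proof -
  obtain b where b: "b n \<in> Aw S v" "weighted_norm S v (b n) \<le> N n"
    "c < Re s \<Longrightarrow> F n s = dirichlet_transform S (b n) s" for n s
    using F unfolding represents_def by metis
  let ?g = "\<lambda>(n, x). b n x" and ?I = "(UNIV :: nat set) \<times> S"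
  have h: "snd ` ?I \<subseteq> S"
    by auto
  have smn: "summable (\<lambda>n. weighted_norm S v (b n))"
    by (rule summable_comparison_test'[OF N, of 0]) (use b weighted_norm_nonneg in auto)
  then have smn': "(\<lambda>n. weighted_norm S v (b n)) summable_on UNIV"
    by (subst summable_on_UNIV_nonneg_real_iff) (auto simp: weighted_norm_nonneg)
  have sm: "(\<lambda>i. norm (?g i) * v (snd i)) summable_on ?I"
    by (rule summable_on_SigmaI[OF _ smn']) (use b Aw_has_sum weight_pos in \<open>auto simp: less_imp_le\<close>)
  note hs = has_sum_infsum[OF sm]
  have "((\<lambda>n. weighted_norm S v (b n)) has_sum (\<Sum>\<^sub>\<infinity>i\<in>?I. norm (?g i) * v (snd i))) UNIV"
    by (rule has_sum_Sigma'[OF hs]) (use b Aw_has_sum in auto)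
  then have "(\<lambda>n. weighted_norm S v (b n)) sums (\<Sum>\<^sub>\<infinity>i\<in>?I. norm (?g i) * v (snd i))"
    by (rule has_sum_imp_sums)
  then have norm_le: "(\<Sum>\<^sub>\<infinity>i\<in>?I. norm (?g i) * v (snd i)) \<le> suminf N"
    using b N by (meson sums_le summable_sums)
  have eq: "(\<Sum>n. F n s) = (\<Sum>\<^sub>\<infinity>i\<in>?I. ?g i * exp (- complex_of_real (snd i) * s))" if s: "c < Re s" for s
  proof -
    have "(\<lambda>i. norm (?g i * exp (- complex_of_real (snd i) * s))) summable_on ?I"
      by (rule Infinite_Sum.abs_summable_on_comparison_test'[OF sm])
         (unfold norm_mult, intro mult_left_mono norm_exp_le_weight, use s in auto)
    then have "((\<lambda>i. ?g i * exp (- complex_of_real (snd i) * s)) has_sum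
       (\<Sum>\<^sub>\<infinity>i\<in>?I. ?g i * exp (- complex_of_real (snd i) * s))) ?I"
      by (rule has_sum_infsum[OF abs_summable_summable])
    then have "((\<lambda>n. F n s) has_sum (\<Sum>\<^sub>\<infinity>i\<in>?I. ?g i * exp (- complex_of_real (snd i) * s))) UNIV"
      by (rule has_sum_Sigma') (use b s transform_has_sum in auto)
    then show ?thesis
      using has_sum_imp_sums sums_unique by fastforce
  qed
  show ?thesis
    unfolding represents_def
    using push_forward[OF h hs] norm_le eq by (intro bexI conjI allI impI) (auto intro: order_trans)
qed

end

section \<open>Dirichlet coefficients as vertical means\<close>

text \<open>Forcing \<open>x\<close> into \<open>F\<close> only shrinks the tail, as the terms are
  nonnegative. It is needed for the coefficient being extracted in the mean value formula, and for
  the constant term when a Dirichlet polynomial is inverted.\<close>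

lemma finite_subset_small_tail:
  fixes f :: "'i \<Rightarrow> real"
  assumes f: "f summable_on S" and pos: "\<And>x. x \<in> S \<Longrightarrow> 0 \<le> f x" and "0 < \<epsilon>" "x \<in> S"
  obtains F where "finite F" "F \<subseteq> S" "x \<in> F" "infsum f (S - F) \<le> \<epsilon>"
proof -
  obtain F where F: "finite F" "F \<subseteq> S" "dist (sum f F) (infsum f S) \<le> \<epsilon>"
    using infsum_finite_approximation[OF f \<open>0 < \<epsilon>\<close>] by blast
  let ?F = "insert x F"
  have "infsum f (S - ?F) = infsum f S - sum f ?F"
    using F \<open>x \<in> S\<close> f by (subst infsum_Diff) auto
  also have "\<dots> \<le> infsum f S - sum f F"
    using F \<open>x \<in> S\<close> pos by (intro diff_left_mono sum_mono2) auto
  also have "\<dots> \<le> \<epsilon>"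
    using F(3) by (simp add: dist_real_def)
  finally show ?thesis
    using F \<open>x \<in> S\<close> by (intro that[of ?F]) auto
qed

text \<open>The bound depends on \<open>s\<close> only through \<open>Re s\<close>, so partial sums
  approximate the transform uniformly on a vertical line.\<close>

lemma dirichlet_transform_tail:
  assumes sm: "(\<lambda>y. norm (b y) * exp (- y * Re s)) summable_on S"
    and F: "finite F" "F \<subseteq> S"
  shows "norm (dirichlet_transform S b s - (\<Sum>y\<in>F. b y * exp (- complex_of_real y * s)))
    \<le> (\<Sum>\<^sub>\<infinity>y\<in>S - F. norm (b y) * exp (- y * Re s))"
proof -
  let ?f = "\<lambda>y. b y * exp (- complex_of_real y * s)"
  have eq: "norm (?f y) = norm (b y) * exp (- y * Re s)" for y
    by (simp add: norm_mult)
  have S: "(\<lambda>y. norm (?f y)) summable_on S"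
    using sm unfolding eq .
  have tail: "(\<lambda>y. norm (?f y)) summable_on (S - F)"
    by (rule summable_on_subset_banach[OF S]) auto
  have "dirichlet_transform S b s - sum ?f F = infsum ?f (S - F)"
    using F abs_summable_summable[OF S] unfolding dirichlet_transform_def by (subst infsum_Diff) auto
  then show ?thesis
    using norm_infsum_bound[OF tail] unfolding eq by simp
qed

text \<open>
  If \<open>\<Phi>\<close> is a primitive of \<open>\<phi>\<close>, this is the mean of \<open>\<phi>\<close> over the segment from \<open>\<sigma> - iT\<close> to
  \<open>\<sigma> + iT\<close>. Working with primitives avoids contour integrals: shifting the line amounts to
  bounding \<open>\<Phi>\<close> along two horizontal segments.
\<close>

definition vertical_mean :: "(complex \<Rightarrow> complex) \<Rightarrow> real \<Rightarrow> real \<Rightarrow> complex" where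
  "vertical_mean \<Phi> \<sigma> T = (\<Phi> (Complex \<sigma> T) - \<Phi> (Complex \<sigma> (- T))) / (2 * of_real T * \<i>)"

text \<open>The mean value inequality on the convex line bounds the increment of
  \<open>\<Phi>\<close> by \<open>B\<close> times the length \<open>2 * T\<close>, which the
  denominator cancels. Only the derivative along the line is needed.\<close>

lemma vertical_mean_le:
  assumes "\<And>s. Re s = \<sigma> \<Longrightarrow> (\<Phi> has_field_derivative \<phi> s) (at s within {s. Re s = \<sigma>})"
    and "\<And>s. Re s = \<sigma> \<Longrightarrow> norm (\<phi> s) \<le> B" and "0 < T"
  shows "norm (vertical_mean \<Phi> \<sigma> T) \<le> B"
proof -
  have line: "convex {s. Re s = \<sigma>}"
  proof -
    have "{s. Re s = \<sigma>} = {s. Re s \<le> \<sigma>} \<inter> {s. \<sigma> \<le> Re s}"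
      by auto
    then show ?thesis
      by (simp add: convex_Int convex_halfspace_Re_le convex_halfspace_Re_ge)
  qed
  have "norm (\<Phi> (Complex \<sigma> T) - \<Phi> (Complex \<sigma> (- T))) \<le> B * norm (Complex \<sigma> T - Complex \<sigma> (- T))"
    by (rule field_differentiable_bound[OF line assms(1,2)]) auto
  also have "Complex \<sigma> T - Complex \<sigma> (- T) = 2 * of_real T * \<i>"
    by (simp add: complex_eq_iff)
  finally show ?thesis
    using \<open>0 < T\<close> unfolding vertical_mean_def norm_divide by (simp add: norm_mult divide_simps)
qed

lemma norm_divide_length_le:
  assumes "norm z \<le> K + K" "0 < T"
  shows "norm (z / (2 * of_real T * \<i>)) \<le> K / T"
proof -
  have "norm z / (2 * T) \<le> (K + K) / (2 * T)"
    using assms by (intro divide_right_mono) auto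
  also have "\<dots> = K / T"
    by simp
  finally show ?thesis
    using \<open>0 < T\<close> by (simp add: norm_divide norm_mult)
qed

text \<open>The frequency \<open>y = x\<close> has primitive \<open>s\<close>, whose mean is exactly
  1. Every other frequency has a primitive bounded on the line, so its mean is
  \<open>O(1 / T)\<close>.\<close>

lemma vertical_mean_exp_polynomial:
  fixes b :: "real \<Rightarrow> complex"
  assumes F: "finite F" "x \<in> F"
  defines "P \<equiv> \<lambda>s. \<Sum>y\<in>F. b y * (if y = x then s else exp (of_real (x - y) * s) / of_real (x - y))"
  shows "(P has_field_derivative (\<Sum>y\<in>F. b y * exp (of_real (x - y) * s))) (at s within A)"
    and "((\<lambda>T. vertical_mean P \<sigma> T) \<longlongrightarrow> b x) at_top"
proof -
  show "(P has_field_derivative (\<Sum>y\<in>F. b y * exp (of_real (x - y) * s))) (at s within A)"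
    unfolding P_def
  proof (intro DERIV_sum DERIV_cmult)
    fix y
    show "((\<lambda>s. if y = x then s else exp (of_real (x - y) * s) / of_real (x - y)) has_field_derivative
      exp (of_real (x - y) * s)) (at s within A)"
    proof (cases "y = x")
      case False
      then have "complex_of_real (x - y) \<noteq> 0"
        by simp
      then have "((\<lambda>s. exp (of_real (x - y) * s) / of_real (x - y)) has_field_derivative
        exp (of_real (x - y) * s)) (at s within A)"
        by (auto intro!: derivative_eq_intros simp del: of_real_diff)
      then show ?thesis
        using False by simp
    qed auto
  qed
  let ?p = "\<lambda>y s. if y = x then s else exp (complex_of_real (x - y) * s) / of_real (x - y)"
  have single: "((\<lambda>T. vertical_mean (?p y) \<sigma> T) \<longlongrightarrow> (if y = x then 1 else 0)) at_top" for y
  proof (cases "y = x")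
    case True
    have "\<forall>\<^sub>F T in at_top. vertical_mean (?p y) \<sigma> T = 1"
      using eventually_gt_at_top[of 0]
    proof eventually_elim
      case (elim T)
      have "Complex \<sigma> T - Complex \<sigma> (- T) = 2 * of_real T * \<i>"
        by (simp add: complex_eq_iff)
      then show ?case
        using True elim by (simp add: vertical_mean_def)
    qed
    then show ?thesis
      using True by (simp add: tendsto_eventually)
  next
    case False
    let ?K = "exp ((x - y) * \<sigma>) / \<bar>x - y\<bar>"
    have bd: "norm (vertical_mean (?p y) \<sigma> T) \<le> ?K / T" if "0 < T" for T
    proof -
      have "norm (?p y s) = ?K" if "Re s = \<sigma>" for s
        using False that by (simp add: norm_divide del: of_real_diff)
      then have "norm (?p y (Complex \<sigma> T) - ?p y (Complex \<sigma> (- T))) \<le> ?K + ?K"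
        by (intro norm_triangle_le_diff add_mono eq_refl) simp_all
      then show ?thesis
        using \<open>0 < T\<close> unfolding vertical_mean_def by (rule norm_divide_length_le)
    qed
    have "((\<lambda>T. ?K / T) \<longlongrightarrow> 0) at_top"
      by (intro real_tendsto_divide_at_top[OF tendsto_const] filterlim_ident)
    moreover have "\<forall>\<^sub>F T in at_top. norm (vertical_mean (?p y) \<sigma> T) \<le> ?K / T"
      using eventually_gt_at_top[of 0] by eventually_elim (rule bd)
    ultimately have "((\<lambda>T. vertical_mean (?p y) \<sigma> T) \<longlongrightarrow> 0) at_top"
      by (rule Lim_null_comparison[rotated])
    then show ?thesis
      using False by simp
  qed
  have "vertical_mean P \<sigma> T = (\<Sum>y\<in>F. b y * vertical_mean (?p y) \<sigma> T)" for T
    unfolding vertical_mean_def P_def sum_subtractf[symmetric] sum_divide_distrib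
    by (intro sum.cong refl) (simp add: right_diff_distrib)
  moreover have "((\<lambda>T. \<Sum>y\<in>F. b y * vertical_mean (?p y) \<sigma> T) \<longlongrightarrow> (\<Sum>y\<in>F. b y * (if y = x then 1 else 0))) at_top"
    by (intro tendsto_sum tendsto_mult tendsto_const single)
  moreover have "(\<Sum>y\<in>F. b y * (if y = x then 1 else 0)) = b x"
    using F by (simp add: if_distrib[of "(*) _"] cong: if_cong)
  ultimately show "((\<lambda>T. vertical_mean P \<sigma> T) \<longlongrightarrow> b x) at_top"
    by simp
qed

text \<open>Bohr's mean value formula. The transform is uniformly close on the line to a finite
  partial sum containing the frequency \<open>x\<close>, and the mean of that partial sum is already
  known to converge to \<open>b x\<close>.\<close>

lemma vertical_mean_tendsto_coefficient:
  assumes sm: "(\<lambda>y. norm (b y) * exp (- y * \<sigma>)) summable_on S" and "x \<in> S"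
    and \<Phi>: "\<And>s. Re s = \<sigma> \<Longrightarrow> (\<Phi> has_field_derivative dirichlet_transform S b s * exp (of_real x * s))
      (at s within {s. Re s = \<sigma>})"
  shows "((\<lambda>T. vertical_mean \<Phi> \<sigma> T) \<longlongrightarrow> b x) at_top"
proof (rule tendstoI)
  fix \<epsilon> :: real
  assume "0 < \<epsilon>"
  \<comment> \<open>The factor \<open>exp (- x * \<sigma>)\<close> compensates for the modulus of
    \<open>exp (of_real x * s)\<close> on the line.\<close>
  define \<eta> where "\<eta> = \<epsilon> / 2 * exp (- x * \<sigma>)"
  have "0 < \<eta>"
    using \<open>0 < \<epsilon>\<close> by (simp add: \<eta>_def)
  obtain F where F: "finite F" "F \<subseteq> S" "x \<in> F"
    and tail: "(\<Sum>\<^sub>\<infinity>y\<in>S - F. norm (b y) * exp (- y * \<sigma>)) \<le> \<eta>"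
    using finite_subset_small_tail[OF sm _ \<open>0 < \<eta>\<close> \<open>x \<in> S\<close>] by auto
  define P where "P = (\<lambda>s. \<Sum>y\<in>F. b y * (if y = x then s else exp (of_real (x - y) * s) / of_real (x - y)))"
  note P = vertical_mean_exp_polynomial[OF F(1,3), of b, folded P_def]
  have "norm (vertical_mean (\<lambda>s. \<Phi> s - P s) \<sigma> T) \<le> \<epsilon> / 2" if "0 < T" for T
  proof (rule vertical_mean_le[OF _ _ that])
    show "((\<lambda>s. \<Phi> s - P s) has_field_derivative
       dirichlet_transform S b s * exp (of_real x * s) - (\<Sum>y\<in>F. b y * exp (of_real (x - y) * s)))
       (at s within {s. Re s = \<sigma>})" if "Re s = \<sigma>" for s
      by (intro derivative_intros \<Phi> P that)
    fix s assume s: "Re s = \<sigma>"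
    have "(\<Sum>y\<in>F. b y * exp (of_real (x - y) * s)) = (\<Sum>y\<in>F. b y * exp (- complex_of_real y * s)) * exp (of_real x * s)"
      unfolding sum_distrib_right
      by (intro sum.cong refl) (simp add: algebra_simps flip: exp_add)
    then have "norm (dirichlet_transform S b s * exp (of_real x * s) - (\<Sum>y\<in>F. b y * exp (of_real (x - y) * s)))
      = norm (dirichlet_transform S b s - (\<Sum>y\<in>F. b y * exp (- complex_of_real y * s))) * exp (x * \<sigma>)"
      using s by (simp add: norm_mult flip: left_diff_distrib)
    also have "\<dots> \<le> \<eta> * exp (x * \<sigma>)"
      using dirichlet_transform_tail[of b s S F] sm F tail s by (intro mult_right_mono) auto
    also have "\<dots> = \<epsilon> / 2"
      by (simp add: \<eta>_def flip: exp_add)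
    finally show "norm (dirichlet_transform S b s * exp (of_real x * s) - (\<Sum>y\<in>F. b y * exp (of_real (x - y) * s))) \<le> \<epsilon> / 2" .
  qed
  moreover have "vertical_mean (\<lambda>s. \<Phi> s - P s) \<sigma> T = vertical_mean \<Phi> \<sigma> T - vertical_mean P \<sigma> T" for T
    by (simp add: vertical_mean_def diff_divide_distrib)
  ultimately have near: "norm (vertical_mean \<Phi> \<sigma> T - vertical_mean P \<sigma> T) \<le> \<epsilon> / 2" if "0 < T" for T
    using that by simp
  have "\<forall>\<^sub>F T in at_top. dist (vertical_mean P \<sigma> T) (b x) < \<epsilon> / 2"
    using P(2) \<open>0 < \<epsilon>\<close> by (intro tendstoD) auto
  then show "\<forall>\<^sub>F T in at_top. dist (vertical_mean \<Phi> \<sigma> T) (b x) < \<epsilon>"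
    using eventually_gt_at_top[of 0]
  proof eventually_elim
    case (elim T)
    then show ?case
      using near[of T] dist_triangle[of "vertical_mean \<Phi> \<sigma> T" "b x" "vertical_mean P \<sigma> T"]
      by (simp add: dist_norm)
  qed
qed

lemma dirichlet_transform_zero_imp_coefficient_zero:
  assumes "(\<lambda>y. norm (b y) * exp (- y * \<sigma>)) summable_on S" and "x \<in> S"
    and zero: "\<And>s. Re s = \<sigma> \<Longrightarrow> dirichlet_transform S b s = 0"
  shows "b x = 0"
proof -
  have "((\<lambda>T. vertical_mean (\<lambda>s. 0) \<sigma> T) \<longlongrightarrow> b x) at_top"
    by (rule vertical_mean_tendsto_coefficient[OF assms(1,2)]) (simp add: zero)
  then have "((\<lambda>T::real. 0) \<longlongrightarrow> b x) at_top"
    by (simp add: vertical_mean_def)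
  then show ?thesis
    by (simp add: tendsto_const_iff)
qed

text \<open>The series need only converge on \<open>Re s = \<sigma>\<close>, where the mean recovers
  \<open>b x\<close>; the estimate is made on \<open>Re s = \<rho>\<close>, where only the bounded
  holomorphic function \<open>G\<close> is available. The two means differ by
  \<open>O(1 / T)\<close>, so the bound survives the limit.\<close>

lemma dirichlet_coefficient_bound:
  assumes sm: "(\<lambda>y. norm (b y) * exp (- y * \<sigma>)) summable_on S" and "x \<in> S"
    and G: "G holomorphic_on {s. r < Re s}" "\<And>s. r < Re s \<Longrightarrow> norm (G s) \<le> M"
    and eq: "\<And>s. Re s = \<sigma> \<Longrightarrow> G s = dirichlet_transform S b s"
    and \<sigma>: "r < \<sigma>" and \<rho>: "r < \<rho>"
  shows "norm (b x) \<le> M * exp (x * \<rho>)"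
proof -
  let ?H = "{s. r < Re s}"
  have hol: "(\<lambda>s. G s * exp (of_real x * s)) holomorphic_on ?H"
    by (intro holomorphic_intros G)
  obtain \<Phi> where \<Phi>: "\<And>s. s \<in> ?H \<Longrightarrow>
      (\<Phi> has_field_derivative G s * exp (of_real x * s)) (at s within ?H)"
    by (rule holomorphic_convex_primitive'[OF convex_halfspace_Re_gt open_halfspace_Re_gt hol]) blast
  have M: "0 \<le> M"
    using order_trans[OF norm_ge_zero G(2)[of "of_real \<sigma>"]] \<sigma> by simp
  have \<Phi>': "(\<Phi> has_field_derivative G s * exp (of_real x * s)) (at s within A)"
    if "A \<subseteq> ?H" "s \<in> A" for s A
    using that by (intro has_field_derivative_subset[OF \<Phi>]) auto
  \<comment> \<open>\<open>E\<close> dominates \<open>exp (of_real x * s)\<close> on the whole strip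
    between the two lines, whichever of them lies further left. Hence \<open>K\<close> bounds the
    increment of \<open>\<Phi>\<close> along a horizontal segment at any height.\<close>
  define E where "E = exp (\<bar>x\<bar> * (\<bar>\<sigma>\<bar> + \<bar>\<rho>\<bar>))"
  define K where "K = M * E * \<bar>\<sigma> - \<rho>\<bar>"
  have shift: "norm (\<Phi> (Complex \<sigma> t) - \<Phi> (Complex \<rho> t)) \<le> K" for t
  proof -
    let ?A = "{s. min \<sigma> \<rho> \<le> Re s} \<inter> {s. Re s \<le> max \<sigma> \<rho>}"
    have A: "?A \<subseteq> ?H"
      using \<sigma> \<rho> by auto
    have "norm (\<Phi> (Complex \<sigma> t) - \<Phi> (Complex \<rho> t)) \<le> M * E * norm (Complex \<sigma> t - Complex \<rho> t)"
    proof (rule field_differentiable_bound)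
      show "convex ?A"
        by (intro convex_Int convex_halfspace_Re_ge convex_halfspace_Re_le)
      show "(\<Phi> has_field_derivative G s * exp (of_real x * s)) (at s within ?A)" if "s \<in> ?A" for s
        using \<Phi>'[OF A that] .
      fix s assume s: "s \<in> ?A"
      have "x * Re s \<le> \<bar>x\<bar> * \<bar>Re s\<bar>"
        by (metis abs_ge_self abs_mult)
      also have "\<dots> \<le> \<bar>x\<bar> * (\<bar>\<sigma>\<bar> + \<bar>\<rho>\<bar>)"
        using s by (intro mult_left_mono) auto
      finally have "norm (exp (complex_of_real x * s)) \<le> E"
        by (simp add: E_def)
      moreover have "norm (G s) \<le> M"
        using G(2) A s by auto
      ultimately show "norm (G s * exp (of_real x * s)) \<le> M * E"
        using M unfolding norm_mult by (intro mult_mono) auto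
    qed auto
    also have "Complex \<sigma> t - Complex \<rho> t = of_real (\<sigma> - \<rho>)"
      by (simp add: complex_eq_iff)
    finally show ?thesis
      unfolding K_def norm_of_real by simp
  qed
  have mean: "norm (vertical_mean \<Phi> \<rho> T) \<le> M * exp (x * \<rho>)" if "0 < T" for T
  proof (rule vertical_mean_le[OF _ _ that])
    show "(\<Phi> has_field_derivative G s * exp (of_real x * s)) (at s within {s. Re s = \<rho>})" if "Re s = \<rho>" for s
      using \<rho> that by (intro \<Phi>') auto
    show "norm (G s * exp (of_real x * s)) \<le> M * exp (x * \<rho>)" if "Re s = \<rho>" for s
      using \<rho> that G(2)[of s] by (simp add: norm_mult)
  qed
  have bd: "norm (vertical_mean \<Phi> \<sigma> T) \<le> M * exp (x * \<rho>) + K / T" if "0 < T" for T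
  proof -
    \<comment> \<open>Regrouping by height writes the difference of the two vertical means as the
      increments along the horizontal segments at heights \<open>T\<close> and
      \<open>- T\<close>.\<close>
    have "norm ((\<Phi> (Complex \<sigma> T) - \<Phi> (Complex \<rho> T)) - (\<Phi> (Complex \<sigma> (- T)) - \<Phi> (Complex \<rho> (- T)))) \<le> K + K"
      by (intro norm_triangle_le_diff add_mono shift)
    then have "norm (((\<Phi> (Complex \<sigma> T) - \<Phi> (Complex \<rho> T)) - (\<Phi> (Complex \<sigma> (- T)) - \<Phi> (Complex \<rho> (- T)))) / (2 * of_real T * \<i>)) \<le> K / T"
      using that by (rule norm_divide_length_le)
    also have "((\<Phi> (Complex \<sigma> T) - \<Phi> (Complex \<rho> T)) - (\<Phi> (Complex \<sigma> (- T)) - \<Phi> (Complex \<rho> (- T)))) / (2 * of_real T * \<i>)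
      = vertical_mean \<Phi> \<sigma> T - vertical_mean \<Phi> \<rho> T"
      by (simp add: vertical_mean_def diff_divide_distrib)
    finally show ?thesis
      using mean[OF that] norm_triangle_sub[of "vertical_mean \<Phi> \<sigma> T" "vertical_mean \<Phi> \<rho> T"] by linarith
  qed
  have lim: "((\<lambda>T. norm (vertical_mean \<Phi> \<sigma> T)) \<longlongrightarrow> norm (b x)) at_top"
  proof (intro tendsto_norm vertical_mean_tendsto_coefficient[OF sm \<open>x \<in> S\<close>])
    show "(\<Phi> has_field_derivative dirichlet_transform S b s * exp (of_real x * s)) (at s within {s. Re s = \<sigma>})"
      if "Re s = \<sigma>" for s
      unfolding eq[OF that, symmetric] using \<sigma> that by (intro \<Phi>') auto
  qed
  have ev: "\<forall>\<^sub>F T in at_top. norm (vertical_mean \<Phi> \<sigma> T) \<le> M * exp (x * \<rho>) + K / T"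
    using eventually_gt_at_top[of 0] by eventually_elim (rule bd)
  have "((\<lambda>T. M * exp (x * \<rho>) + K / T) \<longlongrightarrow> M * exp (x * \<rho>) + 0) at_top"
    by (intro tendsto_add tendsto_const real_tendsto_divide_at_top[OF tendsto_const] filterlim_ident)
  from tendsto_le[OF _ this lim ev] show ?thesis
    by simp
qed

section \<open>Admissible weights on finitely generated semigroups\<close>

text \<open>The map \<open>h\<close> may repeat values, so one preimage of each point is chosen and
  the family restricted to these. This is used for a semigroup whose elements may have several
  expressions in its generators.\<close>

lemma summable_on_image:
  fixes g :: "'b \<Rightarrow> real"
  assumes "(\<lambda>i. g (h i)) summable_on I"
  shows "g summable_on h ` I"
proof -
  let ?J = "inv_into I h ` (h ` I)"
  have "?J \<subseteq> I"
    by (auto intro: inv_into_into)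
  then have "(\<lambda>i. g (h i)) summable_on ?J"
    using assms by (rule summable_on_subset_banach[rotated])
  moreover have "inj_on h ?J"
    by (auto simp: inj_on_def f_inv_into_f)
  moreover have "h ` ?J = h ` I"
    by (simp add: image_image f_inv_into_f cong: image_cong)
  ultimately show ?thesis
    using summable_on_reindex[of h ?J g] by (simp add: o_def)
qed

lemma summable_on_product_nonneg:
  fixes f :: "'a \<Rightarrow> real" and g :: "'b \<Rightarrow> real"
  assumes f: "f summable_on A" and g: "g summable_on B"
    and "\<And>x. x \<in> A \<Longrightarrow> 0 \<le> f x" "\<And>y. y \<in> B \<Longrightarrow> 0 \<le> g y"
  shows "(\<lambda>(x, y). f x * g y) summable_on A \<times> B"
proof (rule summable_on_SigmaI)
  show "((\<lambda>y. case (x, y) of (x, y) \<Rightarrow> f x * g y) has_sum (f x * infsum g B)) B" for x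
    using has_sum_cmult_right[OF has_sum_infsum[OF g]] by simp
  show "(\<lambda>x. f x * infsum g B) summable_on A"
    by (rule summable_on_cmult_left[OF f])
qed (use assms in auto)

section \<open>Injectivity of the transform\<close>

context weighted_semigroup
begin

lemma multiple_mem: "x \<in> S \<Longrightarrow> real k * x \<in> S"
  by (induction k) (auto simp: zero_mem add_mem distrib_right)

lemma represents_cong:
  assumes "represents N F" "\<And>s. c < Re s \<Longrightarrow> F s = G s"
  shows "represents N G"
  using assms unfolding represents_def by metis

lemma unit_elem_in_Aw: "unit_elem \<in> Aw S v"
proof -
  have "(\<lambda>x. norm (unit_elem x) * v x) summable_on {0}"
    by simp
  then have "(\<lambda>x. norm (unit_elem x) * v x) summable_on S"
    by (rule summable_on_cong_neutral[THEN iffD1, rotated -1]) (auto simp: unit_elem_def zero_mem)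
  then show ?thesis
    by (auto simp: Aw_def unit_elem_def zero_mem)
qed

lemma transform_unit_elem: "dirichlet_transform S unit_elem s = 1"
proof -
  have "dirichlet_transform S unit_elem s = (\<Sum>\<^sub>\<infinity>x\<in>{0}. unit_elem x * exp (- complex_of_real x * s))"
    unfolding dirichlet_transform_def
    by (rule infsum_cong_neutral) (auto simp: unit_elem_def zero_mem)
  then show ?thesis
    by (simp add: unit_elem_def)
qed

text \<open>Agreement on one vertical line suffices, because all coefficients of the difference are
  recovered from its means there.\<close>

lemma transform_inject:
  assumes a: "a \<in> Aw S v" and b: "b \<in> Aw S v" and "c \<le> \<tau>"
    and eq: "\<And>s. Re s = \<tau> \<Longrightarrow> dirichlet_transform S a s = dirichlet_transform S b s"
  shows "a = b"
proof
  fix x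
  let ?d = "\<lambda>y. a y - b y"
  have sm: "(\<lambda>y. norm (?d y) * exp (- y * \<tau>)) summable_on S"
  proof (rule summable_on_comparison_test)
    have "(\<lambda>y. norm (a' y) * exp (- y * \<tau>)) summable_on S" if "a' \<in> Aw S v" for a'
      using transform_abs_summable[OF that, of "of_real \<tau>"] \<open>c \<le> \<tau>\<close> by (simp add: norm_mult)
    from summable_on_add[OF this[OF a] this[OF b]]
    show "(\<lambda>y. norm (a y) * exp (- y * \<tau>) + norm (b y) * exp (- y * \<tau>)) summable_on S" .
    show "norm (?d y) * exp (- y * \<tau>) \<le> norm (a y) * exp (- y * \<tau>) + norm (b y) * exp (- y * \<tau>)" for y
      unfolding distrib_right[symmetric] by (intro mult_right_mono norm_triangle_ineq4) simp
  qed simp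
  have "dirichlet_transform S ?d s = 0" if "Re s = \<tau>" for s
  proof -
    have s: "c \<le> Re s"
      using that \<open>c \<le> \<tau>\<close> by simp
    have "((\<lambda>y. a y * exp (- complex_of_real y * s) - b y * exp (- complex_of_real y * s)) has_sum
       (dirichlet_transform S a s - dirichlet_transform S b s)) S"
      using has_sum_add[OF transform_has_sum[OF a s] has_sum_uminusI[OF transform_has_sum[OF b s]]]
      by simp
    then show ?thesis
      using eq[OF that] unfolding dirichlet_transform_def left_diff_distrib by (simp add: infsumI)
  qed
  from dirichlet_transform_zero_imp_coefficient_zero[OF sm _ this]
  show "a x = b x"
    using a b by (cases "x \<in> S") (auto simp: Aw_def)
qed

end

text \<open>Condition (a) of admissibility is hidden in the instance \<open>c = 0\<close>, where
  \<open>exp_le_weight\<close> says that \<open>v\<close> is at least 1 on \<open>S\<close>.\<close>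

locale admissible_semigroup = weighted_semigroup S v 0 for S v +
  assumes root_weight_tendsto: "x \<in> S \<Longrightarrow> (\<lambda>k. root k (v (real k * x))) \<longlonglongrightarrow> 1"
begin

text \<open>A root test: \<open>v (real k * x)\<close> eventually grows at most like
  \<open>exp (\<kappa> * x / 2) ^ k\<close>, which uses up only half of the exponential
  decay.\<close>

lemma summable_multiples:
  assumes x: "x \<in> S" "0 < x" and "0 < \<kappa>"
  shows "(\<lambda>k::nat. exp (- \<kappa> * (real k * x)) * v (real k * x)) summable_on UNIV"
proof -
  let ?r = "exp (\<kappa> * x / 2)"
  have "1 < ?r"
    using assms by simp
  with root_weight_tendsto[OF x(1)] have "\<forall>\<^sub>F k in sequentially. root k (v (real k * x)) < ?r"
    by (rule order_tendstoD)
  then have "\<forall>\<^sub>F k in sequentially. norm (exp (- \<kappa> * (real k * x)) * v (real k * x)) \<le> exp (- \<kappa> * x / 2) ^ k"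
    \<comment> \<open>\<open>root 0\<close> is zero by convention, so a value is recovered from its
      root only for positive \<open>k\<close>.\<close>
    using eventually_gt_at_top[of 0]
  proof eventually_elim
    case (elim k)
    note pos = weight_pos[OF multiple_mem[OF x(1)], of k]
    have "v (real k * x) = root k (v (real k * x)) ^ k"
      using elim pos by simp
    also have "\<dots> \<le> ?r ^ k"
      using elim pos by (intro power_mono) (auto simp: real_root_ge_zero)
    finally have "exp (- \<kappa> * (real k * x)) * v (real k * x) \<le> exp (- \<kappa> * (real k * x)) * ?r ^ k"
      by (intro mult_left_mono) auto
    also have "\<dots> = exp (- \<kappa> * x / 2) ^ k"
      by (simp add: algebra_simps flip: exp_add exp_of_nat_mult)
    finally show ?case
      using pos by simp
  qed
  moreover have "summable (\<lambda>k. exp (- \<kappa> * x / 2) ^ k)"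
    using assms by (intro summable_geometric) simp
  ultimately have "summable (\<lambda>k. exp (- \<kappa> * (real k * x)) * v (real k * x))"
    by (rule summable_comparison_test_ev)
  then show ?thesis
    using weight_pos[OF multiple_mem[OF x(1)]]
    by (subst summable_on_UNIV_nonneg_real_iff) (auto simp: less_imp_le)
qed

text \<open>Induction on the generators. Adjoining \<open>x\<close> replaces \<open>T\<close> by all
  \<open>real k * x + y\<close> with \<open>y \<in> T\<close>; by submultiplicativity the new series
  is dominated by the product of the series over multiples of \<open>x\<close> and the series over
  \<open>T\<close>.\<close>

lemma finitely_generated_exp_summable:
  assumes "finite F" "F \<subseteq> S" and "0 < \<kappa>"
  shows "\<exists>T. F \<subseteq> T \<and> T \<subseteq> S \<and> 0 \<in> T \<and> (\<forall>x\<in>T. \<forall>y\<in>T. x + y \<in> T)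
    \<and> (\<lambda>x. exp (- \<kappa> * x) * v x) summable_on T"
  using assms(1,2)
proof (induction F rule: finite_induct)
  case empty
  show ?case
    by (rule exI[of _ "{0}"]) (simp add: zero_mem)
next
  case (insert x F)
  then have "F \<subseteq> S"
    by simp
  from insert.IH[OF this] obtain T where T: "F \<subseteq> T" "T \<subseteq> S" "0 \<in> T"
    "\<And>x y. x \<in> T \<Longrightarrow> y \<in> T \<Longrightarrow> x + y \<in> T"
    and sm: "(\<lambda>x. exp (- \<kappa> * x) * v x) summable_on T"
    by blast
  show ?case
  \<comment> \<open>The series over multiples of \<open>x\<close> needs \<open>0 < x\<close>; the
    generator 0 already belongs to \<open>T\<close>.\<close>
  proof (cases "x = 0")
    case True
    then show ?thesis
      using T sm by (intro exI[of _ T]) auto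
  next
    case False
    with insert.prems nonneg have x: "x \<in> S" "0 < x"
      by (auto simp: less_le)
    let ?u = "\<lambda>z. exp (- \<kappa> * z) * v z"
    let ?h = "\<lambda>(k, y). real k * x + y"
    let ?T = "?h ` (UNIV \<times> T)"
    have mem: "real k * x \<in> S" "y \<in> S" if "y \<in> T" for k y
      using T(2) that multiple_mem[OF x(1)] by auto
    have "(\<lambda>(k, y). ?u (real k * x) * ?u y) summable_on UNIV \<times> T"
      by (rule summable_on_product_nonneg[OF summable_multiples[OF x \<open>0 < \<kappa>\<close>] sm])
         (use mem T(3) weight_pos in \<open>auto simp: less_imp_le\<close>)
    then have "(\<lambda>i. ?u (?h i)) summable_on UNIV \<times> T"
    proof (rule summable_on_comparison_test)
      fix i :: "nat \<times> real"
      assume "i \<in> UNIV \<times> T"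
      then obtain k y where i: "i = (k, y)" "y \<in> T"
        by auto
      note kS = mem(1)[OF i(2), of k] and yS = mem(2)[OF i(2)]
      have "?u (real k * x + y) \<le> exp (- \<kappa> * (real k * x + y)) * (v (real k * x) * v y)"
        by (intro mult_left_mono weight_add kS yS) simp
      also have "\<dots> = ?u (real k * x) * ?u y"
        by (simp add: algebra_simps flip: exp_add)
      finally show "?u (?h i) \<le> (case i of (k, y) \<Rightarrow> ?u (real k * x) * ?u y)"
        by (simp add: i)
      show "0 \<le> ?u (?h i)"
        using weight_pos[OF add_mem[OF kS yS]] by (simp add: i less_imp_le)
    qed
    then have T_sm: "?u summable_on ?T"
      by (rule summable_on_image)
    have T_gen: "insert x F \<subseteq> ?T"
    proof -
      have "?h (1, 0) \<in> ?T"
        using T(3) by blast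
      moreover have "?h (0, y) \<in> ?T" if "y \<in> F" for y
        using T(1) that by blast
      ultimately show ?thesis
        by force
    qed
    have T_sub: "?T \<subseteq> S"
      using mem by (auto intro: add_mem)
    have T_zero: "0 \<in> ?T"
      using T(3) by (force intro: rev_image_eqI[of "(0, 0)"])
    have T_add: "y + z \<in> ?T" if yz: "y \<in> ?T" "z \<in> ?T" for y z
    proof -
      obtain k l y' z' where *: "y = real k * x + y'" "z = real l * x + z'" "y' \<in> T" "z' \<in> T"
        using yz by auto
      then have "y + z = ?h (k + l, y' + z')"
        by (simp add: algebra_simps)
      then show ?thesis
        using T(4)[OF *(3,4)] by blast
    qed
    show ?thesis
      by (intro exI[of _ ?T] conjI ballI T_gen T_sub T_zero T_add T_sm)
  qed
qed

end

section \<open>Inversion\<close>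

context weighted_semigroup
begin

text \<open>A Neumann series. The norm bound also bounds \<open>F\<close> pointwise by
  \<open>N < 1\<close>, so the series has the expected sum at every \<open>s\<close>.\<close>

lemma represents_inverse:
  assumes F: "represents N F" and N: "0 \<le> N" "N < 1"
  shows "represents (1 / (1 - N)) (\<lambda>s. 1 / (1 - F s))"
proof -
  have "represents (\<Sum>n. N ^ n) (\<lambda>s. \<Sum>n. F s ^ n)"
    using N by (intro represents_suminf represents_power F summable_geometric) simp
  then have "represents (1 / (1 - N)) (\<lambda>s. \<Sum>n. F s ^ n)"
    using N by (simp add: suminf_geometric)
  moreover have "(\<Sum>n. F s ^ n) = 1 / (1 - F s)" if s: "c < Re s" for s
  proof -
    obtain b where b: "b \<in> Aw S v" "weighted_norm S v b \<le> N" "F s = dirichlet_transform S b s"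
      using F s unfolding represents_def by metis
    then have "norm (F s) \<le> N"
      using norm_transform_le[OF b(1), of s] s by simp
    then show ?thesis
      using N by (intro suminf_geometric) simp
  qed
  ultimately show ?thesis
    by (rule represents_cong)
qed

end

section \<open>Inverse powers of Dirichlet polynomials\<close>

lemma norm_exp_diff_le:
  fixes s :: complex
  assumes "0 \<le> y" "- \<kappa> \<le> Re s" "0 \<le> \<kappa>"
  shows "norm (exp (- complex_of_real y * s) - exp (- complex_of_real y * (s + of_real \<kappa>))) \<le> exp (y * \<kappa>) - 1"
proof -
  have "exp (- complex_of_real y * (s + of_real \<kappa>)) = exp (- complex_of_real y * s) * of_real (exp (- y * \<kappa>))"
  proof -
    have "exp (- complex_of_real y * (s + of_real \<kappa>)) = exp (- complex_of_real y * s) * exp (of_real (- y * \<kappa>))"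
      by (simp add: algebra_simps flip: exp_add)
    then show ?thesis
      by (simp only: exp_of_real)
  qed
  then have "exp (- complex_of_real y * s) - exp (- complex_of_real y * (s + of_real \<kappa>))
    = exp (- complex_of_real y * s) * of_real (1 - exp (- y * \<kappa>))"
    by (simp add: right_diff_distrib)
  then have "norm (exp (- complex_of_real y * s) - exp (- complex_of_real y * (s + of_real \<kappa>)))
    = exp (- (y * Re s)) * (1 - exp (- y * \<kappa>))"
    using assms by (simp only: norm_mult norm_of_real) simp
  also have "\<dots> \<le> exp (y * \<kappa>) * (1 - exp (- y * \<kappa>))"
    using assms mult_left_mono[of "- \<kappa>" "Re s" y] by (intro mult_right_mono) auto
  also have "\<dots> = exp (y * \<kappa>) - 1"
    by (simp add: right_diff_distrib flip: exp_add)
  finally show ?thesis .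
qed

text \<open>A point with \<open>Re s > - \<kappa>\<close> is moved by \<open>\<kappa>\<close> into
  the right half-plane. The resulting change of the polynomial is bounded uniformly in
  \<open>s\<close> by a quantity tending to 0 with \<open>\<kappa>\<close>, so any loss
  \<open>\<eta> - \<delta> > 0\<close> can be afforded.\<close>

lemma dirichlet_polynomial_lower_bound_extends:
  fixes a :: "real \<Rightarrow> complex"
  assumes F: "finite F" "F \<subseteq> {0..}" and "\<delta> < \<eta>"
    and lower: "\<And>s. 0 < Re s \<Longrightarrow> \<eta> \<le> norm (\<Sum>y\<in>F. a y * exp (- complex_of_real y * s))"
  obtains \<kappa> where "0 < \<kappa>" "\<And>s. - \<kappa> < Re s \<Longrightarrow> \<delta> \<le> norm (\<Sum>y\<in>F. a y * exp (- complex_of_real y * s))"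
proof -
  let ?f = "\<lambda>s. \<Sum>y\<in>F. a y * exp (- complex_of_real y * s)"
  have "((\<lambda>\<kappa>. \<Sum>y\<in>F. norm (a y) * (exp (y * \<kappa>) - 1)) \<longlongrightarrow> (\<Sum>y\<in>F. norm (a y) * (exp (y * 0) - 1))) (at_right 0)"
    by (intro tendsto_intros)
  then have "\<forall>\<^sub>F \<kappa> in at_right 0. (\<Sum>y\<in>F. norm (a y) * (exp (y * \<kappa>) - 1)) < \<eta> - \<delta>"
    using \<open>\<delta> < \<eta>\<close> by (intro order_tendstoD) auto
  then have "\<forall>\<^sub>F \<kappa> in at_right 0. 0 < \<kappa> \<and> (\<Sum>y\<in>F. norm (a y) * (exp (y * \<kappa>) - 1)) < \<eta> - \<delta>"
    using eventually_at_right_less[of 0] by eventually_elim simp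
  then obtain \<kappa> where \<kappa>: "0 < \<kappa>" "(\<Sum>y\<in>F. norm (a y) * (exp (y * \<kappa>) - 1)) < \<eta> - \<delta>"
    using eventually_happens'[OF trivial_limit_at_right_real] by blast
  have "\<delta> \<le> norm (?f s)" if s: "- \<kappa> < Re s" for s
  proof -
    have "norm (?f s - ?f (s + of_real \<kappa>)) \<le> (\<Sum>y\<in>F. norm (a y) * (exp (y * \<kappa>) - 1))"
      unfolding sum_subtractf[symmetric] right_diff_distrib[symmetric]
      by (intro sum_norm_le) (unfold norm_mult, intro mult_left_mono norm_exp_diff_le, use F s \<kappa> in auto)
    moreover have "\<eta> \<le> norm (?f (s + of_real \<kappa>))"
      using s by (intro lower) simp
    ultimately show ?thesis
      using \<kappa>(2) norm_triangle_ineq2[of "?f (s + of_real \<kappa>)" "?f s"] by (simp add: norm_minus_commute)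
  qed
  with \<kappa>(1) show ?thesis
    by (rule that)
qed

context admissible_semigroup
begin

text \<open>What matters is that \<open>C\<close> does not depend on \<open>n\<close>: it is the sum
  of \<open>exp (- (\<kappa> / 2) * x) * v x\<close> over a semigroup \<open>T\<close> containing
  the exponents of all inverse powers.\<close>

lemma represents_inverse_powers:
  fixes a :: "real \<Rightarrow> complex"
  assumes F: "finite F" "F \<subseteq> S" "0 \<in> F" and \<delta>: "0 < \<delta>" "\<delta> < \<eta>"
  defines "f \<equiv> \<lambda>s. \<Sum>y\<in>F. a y * exp (- complex_of_real y * s)"
  assumes lower: "\<And>s. 0 < Re s \<Longrightarrow> \<eta> \<le> norm (f s)"
  shows "\<exists>C. \<forall>n. represents (C * (1 / \<delta>) ^ n) (\<lambda>s. (1 / f s) ^ n)"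
proof -
  have F0: "F \<subseteq> {0..}"
    using F nonneg by auto
  obtain \<kappa> where \<kappa>: "0 < \<kappa>" "\<And>s. - \<kappa> < Re s \<Longrightarrow> \<delta> \<le> norm (f s)"
    using dirichlet_polynomial_lower_bound_extends[OF F(1) F0 \<delta>(2), of a] lower unfolding f_def by blast
  \<comment> \<open>The line \<open>Re s = - \<kappa> / 2\<close> lies strictly inside the
    half-plane where \<open>f\<close> is bounded below, and still gives exponentially decaying
    coefficients.\<close>
  have "0 < \<kappa> / 2"
    using \<kappa>(1) by simp
  from finitely_generated_exp_summable[OF F(1,2) this]
  obtain T where T: "F \<subseteq> T" "T \<subseteq> S" "0 \<in> T" "\<And>x y. x \<in> T \<Longrightarrow> y \<in> T \<Longrightarrow> x + y \<in> T"
    and smT: "(\<lambda>x. exp (- (\<kappa> / 2) * x) * v x) summable_on T"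
    by blast
  \<comment> \<open>Choosing \<open>\<sigma>\<close> so large that the nonconstant terms total less
    than \<open>\<eta> / 2\<close>, the lower bound at \<open>\<sigma>\<close> forces
    \<open>norm (a 0) > \<eta> / 2\<close>. Dividing by \<open>a 0\<close> then leaves a
    perturbation of norm below 1.\<close>
  let ?F = "F - {0}"
  have "((\<lambda>\<sigma>. \<Sum>y\<in>?F. norm (a y) * exp (- y * \<sigma>)) \<longlongrightarrow> (\<Sum>y\<in>?F. norm (a y) * 0)) at_top"
  proof (intro tendsto_sum tendsto_mult tendsto_const)
    fix y assume "y \<in> ?F"
    then have "- y < 0"
      using F0 by (auto simp: less_le)
    then show "((\<lambda>\<sigma>. exp (- y * \<sigma>)) \<longlongrightarrow> 0) at_top"
      by (intro filterlim_compose[OF exp_at_bot] filterlim_tendsto_neg_mult_at_bot[OF tendsto_const] filterlim_ident)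
  qed
  then have "\<forall>\<^sub>F \<sigma> in at_top. (\<Sum>y\<in>?F. norm (a y) * exp (- y * \<sigma>)) < \<eta> / 2"
    using \<delta> by (intro order_tendstoD) auto
  then have "\<forall>\<^sub>F \<sigma> in at_top. 0 < \<sigma> \<and> (\<Sum>y\<in>?F. norm (a y) * exp (- y * \<sigma>)) < \<eta> / 2"
    using eventually_gt_at_top[of 0] by eventually_elim simp
  then obtain \<sigma> where \<sigma>: "0 < \<sigma>" "(\<Sum>y\<in>?F. norm (a y) * exp (- y * \<sigma>)) < \<eta> / 2"
    using eventually_happens'[OF trivial_limit_at_top_linorder] by blast
  have f_split: "f s = a 0 + (\<Sum>y\<in>?F. a y * exp (- complex_of_real y * s))" for s
    unfolding f_def using F by (subst sum.remove[of F 0]) auto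
  have "norm (\<Sum>y\<in>?F. a y * exp (- complex_of_real y * of_real \<sigma>)) \<le> (\<Sum>y\<in>?F. norm (a y) * exp (- y * \<sigma>))"
    by (intro sum_norm_le) (simp add: norm_mult)
  then have a0: "\<eta> / 2 < norm (a 0)"
    using lower[of "of_real \<sigma>"] \<sigma> f_split[of "of_real \<sigma>"]
      norm_triangle_ineq[of "a 0" "\<Sum>y\<in>?F. a y * exp (- complex_of_real y * of_real \<sigma>)"] by simp
  \<comment> \<open>Far to the right \<open>f\<close> is dominated by its constant term, so that \<open>1 / f\<close> is a Neumann series.\<close>
  interpret W: weighted_semigroup T "\<lambda>x. exp (- \<sigma> * x)" \<sigma>
    by unfold_locales (use T nonneg in \<open>auto simp: distrib_left mult_exp_exp\<close>)
  define N where "N = (\<Sum>y\<in>?F. norm (- a y / a 0) * exp (- \<sigma> * y))"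
  have "N = (\<Sum>y\<in>?F. norm (a y) * exp (- y * \<sigma>)) / norm (a 0)"
    by (simp add: N_def norm_divide sum_divide_distrib mult.commute)
  also have "\<dots> < 1"
    using \<sigma> a0 by (simp add: divide_simps)
  finally have "N < 1" .
  have "0 \<le> N"
    unfolding N_def by (intro sum_nonneg) simp
  have "W.represents N (\<lambda>s. \<Sum>y\<in>?F. - a y / a 0 * exp (- complex_of_real y * s))"
    unfolding N_def using F(1) T(1) by (intro W.represents_finite_sum) auto
  from W.represents_mult[OF W.represents_const[of "1 / a 0"] W.represents_inverse[OF this \<open>0 \<le> N\<close> \<open>N < 1\<close>]]
  have "W.represents (norm (1 / a 0) * (1 / (1 - N)))
    (\<lambda>s. 1 / a 0 * (1 / (1 - (\<Sum>y\<in>?F. - a y / a 0 * exp (- complex_of_real y * s)))))" .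
  moreover have "1 / a 0 * (1 / (1 - (\<Sum>y\<in>?F. - a y / a 0 * exp (- complex_of_real y * s)))) = 1 / f s" for s
  proof -
    have "a 0 \<noteq> 0"
      using a0 \<delta> by auto
    then have "f s = a 0 * (1 - (\<Sum>y\<in>?F. - a y / a 0 * exp (- complex_of_real y * s)))"
      by (simp add: f_split distrib_left sum_distrib_left sum_negf)
    then show ?thesis
      by simp
  qed
  ultimately have "W.represents (norm (1 / a 0) * (1 / (1 - N))) (\<lambda>s. 1 / f s)"
    by simp
  note inv_power = W.represents_power[OF this]
  define C where "C = (\<Sum>\<^sub>\<infinity>x\<in>T. exp (- (\<kappa> / 2) * x) * v x)"
  have "represents (C * (1 / \<delta>) ^ n) (\<lambda>s. (1 / f s) ^ n)" for n
  proof -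
    obtain b where b: "b \<in> Aw T (\<lambda>x. exp (- \<sigma> * x))"
      and b_eq: "\<And>s. \<sigma> < Re s \<Longrightarrow> (1 / f s) ^ n = dirichlet_transform T b s"
      using inv_power[of n] unfolding W.represents_def by blast
    have b_off: "b x = 0" if "x \<notin> T" for x
      using b that by (simp add: Aw_def)
    have f_nz: "f s \<noteq> 0" if "- \<kappa> < Re s" for s
      using \<kappa>(2)[OF that] \<delta> by auto
    \<comment> \<open>The line shift starts at \<open>\<sigma> + 1\<close> because \<open>b\<close>
      represents the power only for \<open>Re s > \<sigma>\<close>. It ends at
      \<open>- \<kappa> / 2\<close>, where the power itself is holomorphic and bounded by
      \<open>(1 / \<delta>) ^ n\<close>.\<close>
    have bound: "norm (b x) \<le> (1 / \<delta>) ^ n * exp (x * (- (\<kappa> / 2)))" if "x \<in> T" for x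
    proof (rule dirichlet_coefficient_bound[OF _ that])
      show "(\<lambda>y. norm (b y) * exp (- y * (\<sigma> + 1))) summable_on T"
        using W.transform_abs_summable[OF b, of "of_real (\<sigma> + 1)"] by (simp add: norm_mult)
      show "(\<lambda>s. (1 / f s) ^ n) holomorphic_on {s. - \<kappa> < Re s}"
        unfolding f_def
        by (intro holomorphic_intros) (use f_nz in \<open>simp add: f_def\<close>)
      show "norm ((1 / f s) ^ n) \<le> (1 / \<delta>) ^ n" if "- \<kappa> < Re s" for s
        unfolding norm_power norm_divide using \<kappa>(2)[OF that] \<delta>
        by (intro power_mono frac_le) auto
      show "(1 / f s) ^ n = dirichlet_transform T b s" if "Re s = \<sigma> + 1" for s
        using that by (intro b_eq) simp
    qed (use \<kappa>(1) \<sigma>(1) in auto)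
    have sm_maj: "(\<lambda>x. (1 / \<delta>) ^ n * (exp (- (\<kappa> / 2) * x) * v x)) summable_on T"
      by (rule summable_on_cmult_right[OF smT])
    have maj: "norm (b x) * v x \<le> (1 / \<delta>) ^ n * (exp (- (\<kappa> / 2) * x) * v x)" if "x \<in> T" for x
      using mult_right_mono[OF bound[OF that], of "v x"] weight_pos[of x] T(2) that
      by (auto simp: mult_ac less_imp_le)
    have smb: "(\<lambda>x. norm (b x) * v x) summable_on T"
      by (rule summable_on_comparison_test[OF sm_maj maj]) (use T(2) weight_pos in \<open>auto simp: less_imp_le\<close>)
    have bS: "b \<in> Aw S v"
      unfolding Aw_def using smb T(2) b_off
      by (auto intro: summable_on_cong_neutral[THEN iffD1, rotated -1])
    have "weighted_norm S v b = (\<Sum>\<^sub>\<infinity>x\<in>T. norm (b x) * v x)"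
      unfolding weighted_norm_def by (rule infsum_cong_neutral) (use T(2) b_off in auto)
    also have "\<dots> \<le> (\<Sum>\<^sub>\<infinity>x\<in>T. (1 / \<delta>) ^ n * (exp (- (\<kappa> / 2) * x) * v x))"
      by (rule infsum_mono[OF smb sm_maj maj])
    also have "\<dots> = C * (1 / \<delta>) ^ n"
      unfolding C_def infsum_cmult_right' by (rule mult.commute)
    finally have norm_b: "weighted_norm S v b \<le> C * (1 / \<delta>) ^ n" .
    have transform_TS: "dirichlet_transform T b s = dirichlet_transform S b s" for s
      unfolding dirichlet_transform_def by (rule infsum_cong_neutral) (use T(2) b_off in auto)
    obtain p where p: "p \<in> Aw S v" "\<And>s. 0 < Re s \<Longrightarrow> f s ^ n = dirichlet_transform S p s"
      using represents_power[OF represents_finite_sum[OF F(1,2), of a], of n]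
      unfolding represents_def f_def by blast
    \<comment> \<open>Uniqueness of coefficients extends \<open>f ^ n * b = 1\<close> from \<open>Re s > \<sigma>\<close> to \<open>Re s > 0\<close>.\<close>
    have "conv S p b = unit_elem"
    proof (rule transform_inject[OF conv_in_Aw[OF p(1) bS] unit_elem_in_Aw])
      show "0 \<le> \<sigma> + 1"
        using \<sigma>(1) by simp
      fix s assume s: "Re s = \<sigma> + 1"
      then have "dirichlet_transform S (conv S p b) s = f s ^ n * (1 / f s) ^ n"
        using \<sigma>(1) by (subst transform_conv[OF p(1) bS]) (auto simp: p(2) b_eq transform_TS)
      also have "\<dots> = 1"
        using f_nz[of s] s \<sigma>(1) \<kappa>(1) by (simp flip: power_mult_distrib)
      finally show "dirichlet_transform S (conv S p b) s = dirichlet_transform S unit_elem s"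
        by (simp add: transform_unit_elem)
    qed
    then have prod: "f s ^ n * dirichlet_transform S b s = 1" if "0 < Re s" for s
      using transform_conv[OF p(1) bS, of s] that by (simp add: p(2) transform_unit_elem)
    have "(1 / f s) ^ n = dirichlet_transform S b s" if "0 < Re s" for s
      using prod[OF that] f_nz[of s] that \<kappa>(1) by (simp add: field_simps)
    with bS norm_b show ?thesis
      unfolding represents_def by blast
  qed
  then show ?thesis
    by blast
qed

section \<open>Invertibility and lower bounds for the transform\<close>

lemma represents_imp_invertible:
  assumes a: "a \<in> Aw S v" and inv: "represents N (\<lambda>s. 1 / dirichlet_transform S a s)"
    and nz: "\<And>s. 0 < Re s \<Longrightarrow> dirichlet_transform S a s \<noteq> 0"
  shows "invertible_Aw S v a"
proof -
  obtain b where b: "b \<in> Aw S v" "\<And>s. 0 < Re s \<Longrightarrow> 1 / dirichlet_transform S a s = dirichlet_transform S b s"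
    using inv unfolding represents_def by blast
  have "conv S a b = unit_elem"
  proof (rule transform_inject[OF conv_in_Aw[OF a b(1)] unit_elem_in_Aw])
    show "0 \<le> (1 :: real)"
      by simp
    fix s :: complex assume "Re s = 1"
    then show "dirichlet_transform S (conv S a b) s = dirichlet_transform S unit_elem s"
      using nz[of s] by (simp add: transform_conv[OF a b(1)] transform_unit_elem flip: b(2))
  qed
  with a b(1) show ?thesis
    unfolding invertible_Aw_def by blast
qed

text \<open>The margins are chosen so that \<open>norm (h s) \<le> \<delta> / 4\<close> leaves
  \<open>norm (f s) \<ge> 3 * \<delta> / 4\<close>. Inverse powers of \<open>f\<close> can then be
  controlled with ratio \<open>2 / \<delta>\<close>, and the terms of Newman's series have norms
  bounded geometrically with ratio \<open>(\<delta> / 4) * (2 / \<delta>) = 1 / 2\<close>.\<close>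

lemma invertible_if_bounded_below:
  assumes a: "a \<in> Aw S v" and "0 < \<delta>"
    and lower: "\<And>s. 0 < Re s \<Longrightarrow> \<delta> \<le> norm (dirichlet_transform S a s)"
  shows "invertible_Aw S v a"
proof -
  have sm: "(\<lambda>x. norm (a x) * v x) summable_on S"
    using a by (simp add: Aw_def)
  obtain F where F: "finite F" "F \<subseteq> S" "0 \<in> F" and tail: "(\<Sum>\<^sub>\<infinity>x\<in>S - F. norm (a x) * v x) \<le> \<delta> / 4"
    using finite_subset_small_tail[OF sm _ _ zero_mem, of "\<delta> / 4"] \<open>0 < \<delta>\<close> weight_pos
    by (auto simp: less_imp_le)
  define f where "f = (\<lambda>s. \<Sum>y\<in>F. a y * exp (- complex_of_real y * s))"
  define h where "h = (\<lambda>s. f s - dirichlet_transform S a s)"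
  \<comment> \<open>These are the coefficients of \<open>f\<close> minus the transform of
    \<open>a\<close>: they cancel on \<open>F\<close> and leave the negated tail elsewhere.\<close>
  let ?h = "\<lambda>x. if x \<in> F then 0 else - a x"
  have tail_sm: "(\<lambda>x. norm (a x) * v x) summable_on (S - F)"
    by (rule summable_on_subset_banach[OF sm]) auto
  have "(\<lambda>x. norm (?h x) * v x) summable_on S"
    by (rule summable_on_cong_neutral[THEN iffD1, OF _ _ _ tail_sm]) auto
  then have h_in: "?h \<in> Aw S v"
    using a F(2) by (auto simp: Aw_def)
  have norm_h: "weighted_norm S v ?h \<le> \<delta> / 4"
  proof -
    have "weighted_norm S v ?h = (\<Sum>\<^sub>\<infinity>x\<in>S - F. norm (a x) * v x)"
      unfolding weighted_norm_def by (rule infsum_cong_neutral) auto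
    with tail show ?thesis
      by simp
  qed
  have h_eq: "h s = dirichlet_transform S ?h s" if "0 \<le> Re s" for s
  proof -
    have "dirichlet_transform S ?h s = (\<Sum>\<^sub>\<infinity>x\<in>S - F. - (a x * exp (- complex_of_real x * s)))"
      unfolding dirichlet_transform_def by (rule infsum_cong_neutral) auto
    also have "\<dots> = - (dirichlet_transform S a s - f s)"
      unfolding infsum_uminus dirichlet_transform_def f_def
      using F has_sum_imp_summable[OF transform_has_sum[OF a that]] by (subst infsum_Diff) auto
    finally show ?thesis
      by (simp add: h_def)
  qed
  have rep_h: "represents (\<delta> / 4) h"
    unfolding represents_def using h_in norm_h h_eq by (intro bexI[of _ ?h]) auto
  have h_le: "norm (h s) \<le> \<delta> / 4" if "0 < Re s" for s
    using norm_transform_le[OF h_in, of s] norm_h h_eq[of s] that by simp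
  have f_ge: "3 * \<delta> / 4 \<le> norm (f s)" if "0 < Re s" for s
    using lower[OF that] h_le[OF that] norm_triangle_ineq2[of "dirichlet_transform S a s" "f s"]
    by (simp add: h_def norm_minus_commute)
  obtain C where C: "\<And>n. represents (C * (1 / (\<delta> / 2)) ^ n) (\<lambda>s. (1 / f s) ^ n)"
    using represents_inverse_powers[OF F, of "\<delta> / 2" "3 * \<delta> / 4" a] \<open>0 < \<delta>\<close> f_ge
    unfolding f_def by auto
  have summand: "represents (C * (2 / \<delta>) * (1 / 2) ^ n) (\<lambda>s. h s ^ n * (1 / f s) ^ Suc n)" for n
  proof -
    have "(\<delta> / 4) ^ n * (C * (1 / (\<delta> / 2)) ^ Suc n) = C * (2 / \<delta>) * ((\<delta> / 4) * (2 / \<delta>)) ^ n"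
      by (simp only: power_mult_distrib) simp
    also have "(\<delta> / 4) * (2 / \<delta>) = 1 / 2"
      using \<open>0 < \<delta>\<close> by simp
    finally have eq: "(\<delta> / 4) ^ n * (C * (1 / (\<delta> / 2)) ^ Suc n) = C * (2 / \<delta>) * (1 / 2) ^ n" .
    show ?thesis
      using represents_mult[OF represents_power[OF rep_h, of n] C[of "Suc n"]] unfolding eq .
  qed
  have "summable (\<lambda>n. C * (2 / \<delta>) * (1 / 2) ^ n)"
    by (intro summable_mult summable_geometric) simp
  note sum = represents_suminf[OF summand this]
  have nz: "dirichlet_transform S a s \<noteq> 0" if "0 < Re s" for s
    using lower[OF that] \<open>0 < \<delta>\<close> by auto
  have "(\<Sum>n. h s ^ n * (1 / f s) ^ Suc n) = 1 / dirichlet_transform S a s" if s: "0 < Re s" for s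
  proof -
    have f0: "f s \<noteq> 0"
      using f_ge[OF s] \<open>0 < \<delta>\<close> by auto
    have "norm (h s / f s) < 1"
      using h_le[OF s] f_ge[OF s] \<open>0 < \<delta>\<close> f0 by (simp add: norm_divide divide_simps)
    then have "(\<lambda>n. 1 / f s * (h s / f s) ^ n) sums (1 / f s * (1 / (1 - h s / f s)))"
      by (intro sums_mult geometric_sums)
    moreover have "(\<lambda>n. 1 / f s * (h s / f s) ^ n) = (\<lambda>n. h s ^ n * (1 / f s) ^ Suc n)"
      by (simp add: power_divide)
    moreover have "1 / f s * (1 / (1 - h s / f s)) = 1 / dirichlet_transform S a s"
      using f0 nz[OF s] by (simp add: h_def field_simps)
    ultimately show ?thesis
      using sums_unique by metis
  qed
  then have "represents (\<Sum>n. C * (2 / \<delta>) * (1 / 2) ^ n) (\<lambda>s. 1 / dirichlet_transform S a s)"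
    by (rule represents_cong[OF sum])
  from represents_imp_invertible[OF a this nz] show ?thesis .
qed

text \<open>The transforms of \<open>a\<close> and its inverse multiply to 1, and the latter is
  bounded by its norm. Adding 1 to that norm keeps the denominator visibly positive.\<close>

lemma bounded_below_if_invertible:
  assumes "invertible_Aw S v a"
  obtains \<delta> where "0 < \<delta>" "\<And>s. 0 < Re s \<Longrightarrow> \<delta> \<le> norm (dirichlet_transform S a s)"
proof -
  obtain b where a: "a \<in> Aw S v" and b: "b \<in> Aw S v" and inv: "conv S a b = unit_elem"
    using assms unfolding invertible_Aw_def by blast
  let ?N = "weighted_norm S v b + 1"
  have N: "0 < ?N"
    using weighted_norm_nonneg[of b] by simp
  have "1 / ?N \<le> norm (dirichlet_transform S a s)" if s: "0 < Re s" for s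
  proof -
    have "1 = norm (dirichlet_transform S (conv S a b) s)"
      unfolding inv transform_unit_elem by simp
    also have "\<dots> = norm (dirichlet_transform S a s) * norm (dirichlet_transform S b s)"
      using s by (simp add: transform_conv[OF a b] norm_mult)
    also have "\<dots> \<le> norm (dirichlet_transform S a s) * ?N"
      using norm_transform_le[OF b, of s] s by (intro mult_left_mono) auto
    finally show ?thesis
      using N by (simp add: divide_simps)
  qed
  with N show ?thesis
    by (intro that[of "1 / ?N"]) auto
qed

end

theorem theorem1:
  fixes \<Lambda> :: "real set" and w :: "real \<Rightarrow> real"
  assumes "\<Lambda> \<subseteq> {0..}" and "0 \<in> \<Lambda>"
    and "\<forall>x\<in>\<Lambda>. \<forall>y\<in>\<Lambda>. x + y \<in> \<Lambda>"
    and "admissible_weight \<Lambda> w"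
  shows "{a. invertible_Aw \<Lambda> w a} =
         {a \<in> Aw \<Lambda> w. 0 \<notin> closure (dirichlet_transform \<Lambda> a ` right_half_plane)}"
proof -
  interpret admissible_semigroup \<Lambda> w
    by unfold_locales (use assms in \<open>auto simp: admissible_weight_def weight_function_def\<close>)
  have closure_iff: "0 \<notin> closure (dirichlet_transform \<Lambda> a ` right_half_plane) \<longleftrightarrow>
    (\<exists>\<delta>>0. \<forall>s. 0 < Re s \<longrightarrow> \<delta> \<le> norm (dirichlet_transform \<Lambda> a s))" for a
    by (simp add: closure_approachable right_half_plane_def not_less) (meson not_le)
  show ?thesis
  proof (intro Collect_cong iffI conjI)
    fix a
    assume inv: "invertible_Aw \<Lambda> w a"
    then show "a \<in> Aw \<Lambda> w"
      by (simp add: invertible_Aw_def)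
    show "0 \<notin> closure (dirichlet_transform \<Lambda> a ` right_half_plane)"
      using bounded_below_if_invertible[OF inv] closure_iff by metis
  next
    fix a
    assume "a \<in> Aw \<Lambda> w \<and> 0 \<notin> closure (dirichlet_transform \<Lambda> a ` right_half_plane)"
    then show "invertible_Aw \<Lambda> w a"
      using invertible_if_bounded_below closure_iff by metis
  qed
qed

end
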